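(* Let $a,b\in\mathbb{Q}_p$, $a\neq0$, be such that $\sqrt{a^2-4b}$ exists in $\mathbb{Q}_p$, and let $$f(x)=\frac{ax^2+bx}{x^2+ax+b},\qquad x\in\mathbb{Q}_p,\ x\neq\hat x_1,\hat x_2,$$ where $\hat x_{1,2}=\frac{-a\pm\sqrt{a^2-4b}}{2}$ are the zeros of $x^2+ax+b$. Put $\delta=|a|_p$, $\alpha=|\hat x_1|_p$, $\beta=|\hat x_2|_p$, the roots being labelled so that $\alpha\leq\beta$. Let $A=\{r:0\leq r<\alpha\}$ if $\delta\leq\alpha=\beta$, and $A=[0,\beta)\setminus\{\alpha\}$ if $\alpha<\beta=\delta$. Then the sphere $S_r(0)$ is invariant for $f$ if and only if $r\in A$.
   Context: $p$ is a prime, $|\cdot|_p$ is the $p$-adic norm on the field $\mathbb{Q}_p$ of $p$-adic numbers, and $S_r(0)=\{x\in\mathbb{Q}_p:|x|_p=r\}$ for $r\geq0$. The point $0$ is the unique fixed point of $f$. One has $\delta\leq\max\{\alpha,\beta\}$ because $\hat x_1+\hat x_2=-a$, so one of the two cases in the definition of $A$ always occurs. The sphere $S_r(0)$ is invariant for $f$ if for every $x\in S_r(0)$ all iterates $f^n(x)$, $n=1,2,\dots$, (are defined and) belong to $S_r(0)$.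
   Formalization: The sphere S_r(0) is assumed nonempty (r = 0 or an integral power of p); for other r the sphere is empty, hence vacuously invariant, and the "only if" part fails, e.g. for r > β. *)

theory Defs
  imports Complex_Main "HOL-Computational_Algebra.Squarefree" "Berlekamp_Zassenhaus.Finite_Field"
begin

section \<open>The \<open>p\<close>-adic absolute value on the rationals\<close>

definition padic_abs :: "nat \<Rightarrow> rat \<Rightarrow> real" where
  "padic_abs p x = (if x = 0 then 0
     else real p powi (int (multiplicity (int p) (snd (quotient_of x)))
                     - int (multiplicity (int p) (fst (quotient_of x)))))"

lemma padic_abs_0 [simp]: "padic_abs p 0 = 0"
  by (simp add: padic_abs_def)

lemma padic_abs_fract:
  assumes "prime p" "a \<noteq> 0" "b \<noteq> 0"
  shows "padic_abs p (of_int a / of_int b)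
       = real p powi (int (multiplicity (int p) b) - int (multiplicity (int p) a))"
proof -
  define x :: rat where "x = of_int a / of_int b"
  obtain c d where cd: "quotient_of x = (c, d)" by (cases "quotient_of x")
  have d: "d > 0" using quotient_of_denom_pos[OF cd] .
  have x: "x = of_int c / of_int d" using quotient_of_div[OF cd] .
  have x0: "x \<noteq> 0" using assms by (simp add: x_def)
  hence c: "c \<noteq> 0" using x by auto
  have "of_int a * of_int d = (of_int c * of_int b :: rat)"
    using x assms d unfolding x_def by (simp add: frac_eq_eq)
  hence ad: "a * d = c * b" by (metis of_int_eq_iff of_int_mult)
  have pe: "prime_elem (int p)" using assms(1) by simp
  have "multiplicity (int p) a + multiplicity (int p) d
      = multiplicity (int p) c + multiplicity (int p) b"
    using ad assms c d prime_elem_multiplicity_mult_distrib[OF pe, of a d]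
      prime_elem_multiplicity_mult_distrib[OF pe, of c b] by simp
  thus ?thesis using x0 cd unfolding x_def[symmetric] padic_abs_def
    by (auto intro!: arg_cong[where f = "\<lambda>k. real p powi k"])
qed

lemma padic_abs_nonneg [simp]: "padic_abs p x \<ge> 0"
  by (simp add: padic_abs_def)

lemma padic_abs_eq_0_iff [simp]: "prime p \<Longrightarrow> padic_abs p x = 0 \<longleftrightarrow> x = 0"
  by (auto simp: padic_abs_def power_int_eq_0_iff prime_gt_0_nat)

lemma padic_abs_1 [simp]: "padic_abs p 1 = 1"
  by (simp add: padic_abs_def)

lemma padic_abs_minus [simp]: "padic_abs p (- x) = padic_abs p x"
  by (auto simp: padic_abs_def rat_uminus_code Let_def split: prod.splits)

lemma padic_abs_diff_commute: "padic_abs p (x - y) = padic_abs p (y - x)"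
  using padic_abs_minus[of p "x - y"] by simp

lemma rat_common_denominator:
  obtains a b d where "d \<noteq> 0" "(x::rat) = of_int a / of_int d" "(y::rat) = of_int b / of_int d"
proof -
  obtain a c where ac: "quotient_of x = (a, c)" by (cases "quotient_of x")
  obtain b d where bd: "quotient_of y = (b, d)" by (cases "quotient_of y")
  have "c > 0" "d > 0" using quotient_of_denom_pos[OF ac] quotient_of_denom_pos[OF bd] by auto
  thus ?thesis using that[of "c * d" "a * d" "b * c"] quotient_of_div[OF ac] quotient_of_div[OF bd]
    by auto
qed

lemma padic_abs_mult:
  assumes "prime p"
  shows "padic_abs p (x * y) = padic_abs p x * padic_abs p y"
proof (cases "x = 0 \<or> y = 0")
  case False
  obtain a b d where 1: "d \<noteq> 0" "x = of_int a / of_int d" "y = of_int b / of_int d"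
    by (rule rat_common_denominator)
  have 2: "a \<noteq> 0" "b \<noteq> 0" using False 1 by auto
  have 3: "x * y = of_int (a * b) / of_int (d * d)" using 1 by simp
  have pe: "prime_elem (int p)" using assms(1) by simp
  have p0: "real p \<noteq> 0" using assms by (simp add: prime_gt_0_nat)
  have 4: "a * b \<noteq> 0" "d * d \<noteq> 0" using 1(1) 2 by auto
  show ?thesis
    unfolding 3 padic_abs_fract[OF assms 4]
    unfolding 1(2,3) padic_abs_fract[OF assms 2(1) 1(1)] padic_abs_fract[OF assms 2(2) 1(1)]
    using 1(1) 2 p0
    by (subst power_int_add[symmetric])
       (auto simp: prime_elem_multiplicity_mult_distrib[OF pe]
             intro!: arg_cong[where f = "\<lambda>k. real p powi k"])
qed auto

lemma padic_abs_add_le: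
  assumes "prime p"
  shows "padic_abs p (x + y) \<le> max (padic_abs p x) (padic_abs p y)"
proof (cases "x = 0 \<or> y = 0 \<or> x + y = 0")
  case True
  thus ?thesis by (auto simp: le_max_iff_disj)
next
  case False
  obtain a b d where 1: "d \<noteq> 0" "x = of_int a / of_int d" "y = of_int b / of_int d"
    by (rule rat_common_denominator)
  have xy: "x + y = of_int (a + b) / of_int d" using 1 by (simp add: add_divide_distrib)
  have 2: "a \<noteq> 0" "b \<noteq> 0" using False 1 by auto
  have 3: "a + b \<noteq> 0" using False xy by auto
  let ?m = "multiplicity (int p)"
  let ?k = "min (?m a) (?m b)"
  have "int p ^ ?k dvd a" "int p ^ ?k dvd b" by (auto intro!: multiplicity_dvd')
  hence "int p ^ ?k dvd a + b" by (rule dvd_add)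
  moreover have "\<not> is_unit (int p)" using assms by auto
  ultimately have "?k \<le> ?m (a + b)" using 3 by (intro multiplicity_geI) auto
  hence "?m a \<le> ?m (a + b) \<or> ?m b \<le> ?m (a + b)" by linarith
  moreover have "real p \<ge> 1" using prime_gt_0_nat[OF assms] by simp
  ultimately show ?thesis
    unfolding xy padic_abs_fract[OF assms 3 1(1)] unfolding 1(2,3)
      padic_abs_fract[OF assms 2(1) 1(1)] padic_abs_fract[OF assms 2(2) 1(1)] le_max_iff_disj
    by (auto intro!: power_int_increasing)
qed

lemma padic_abs_inverse:
  assumes "prime p" shows "padic_abs p (inverse x) = inverse (padic_abs p x)"
proof (cases "x = 0")
  case False
  hence "padic_abs p x * padic_abs p (inverse x) = 1"
    using padic_abs_mult[OF assms, of x "inverse x"] by simp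
  thus ?thesis by (metis inverse_unique)
qed auto

lemma padic_abs_triangle:
  assumes "prime p" shows "padic_abs p (x + y) \<le> padic_abs p x + padic_abs p y"
  using padic_abs_add_le[OF assms, of x y] padic_abs_nonneg[of p x] padic_abs_nonneg[of p y]
  by linarith

lemma padic_abs_triangle_diff:
  assumes "prime p" shows "\<bar>padic_abs p x - padic_abs p y\<bar> \<le> padic_abs p (x - y)"
  using padic_abs_triangle[OF assms, of "x - y" y] padic_abs_triangle[OF assms, of "y - x" x]
    padic_abs_diff_commute[of p x y] by (simp add: abs_le_iff)

section \<open>Cauchy sequences and null sequences\<close>

definition padic_cauchy :: "nat \<Rightarrow> (nat \<Rightarrow> rat) \<Rightarrow> bool" where
  "padic_cauchy p X \<longleftrightarrow> (\<forall>e>0. \<exists>N. \<forall>m\<ge>N. \<forall>n\<ge>N. padic_abs p (X m - X n) < e)"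

definition padic_null :: "nat \<Rightarrow> (nat \<Rightarrow> rat) \<Rightarrow> bool" where
  "padic_null p X \<longleftrightarrow> (\<lambda>n. padic_abs p (X n)) \<longlonglongrightarrow> 0"

definition padic_rel :: "nat \<Rightarrow> (nat \<Rightarrow> rat) \<Rightarrow> (nat \<Rightarrow> rat) \<Rightarrow> bool" where
  "padic_rel p X Y \<longleftrightarrow> padic_cauchy p X \<and> padic_cauchy p Y \<and> padic_null p (\<lambda>n. X n - Y n)"

lemma padic_cauchy_const [simp]: "padic_cauchy p (\<lambda>n. c)"
  by (simp add: padic_cauchy_def)

lemma padic_null_0 [simp]: "padic_null p (\<lambda>n. 0)"
  by (simp add: padic_null_def)

lemma padic_null_minus: "padic_null p (\<lambda>n. - X n) \<longleftrightarrow> padic_null p X"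
  by (simp add: padic_null_def)

lemma padic_null_le:
  assumes "padic_null p X" "eventually (\<lambda>n. padic_abs p (Y n) \<le> B * padic_abs p (X n)) sequentially"
  shows "padic_null p Y"
  unfolding padic_null_def
proof (rule tendsto_sandwich[of "\<lambda>_. 0", OF _ assms(2) tendsto_const])
  show "(\<lambda>n. B * padic_abs p (X n)) \<longlonglongrightarrow> 0"
    using tendsto_mult_left[OF assms(1)[unfolded padic_null_def], of B] by simp
qed auto

lemma padic_null_add:
  assumes "prime p" "padic_null p X" "padic_null p Y"
  shows "padic_null p (\<lambda>n. X n + Y n)"
  unfolding padic_null_def
proof (rule tendsto_sandwich[of "\<lambda>_. 0", OF _ _ tendsto_const])
  show "(\<lambda>n. padic_abs p (X n) + padic_abs p (Y n)) \<longlonglongrightarrow> 0"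
    using tendsto_add[OF assms(2,3)[unfolded padic_null_def]] by simp
qed (auto intro!: always_eventually padic_abs_triangle assms)

lemma padic_cauchy_abs:
  assumes "prime p" "padic_cauchy p X"
  shows "convergent (\<lambda>n. padic_abs p (X n))"
  unfolding Cauchy_convergent_iff[symmetric] Cauchy_def dist_real_def
  using assms(2) unfolding padic_cauchy_def
  by (meson order.strict_trans1 padic_abs_triangle_diff[OF assms(1)])

lemma padic_cauchy_bounded:
  assumes "prime p" "padic_cauchy p X"
  obtains B where "B > 0" "\<And>n. padic_abs p (X n) \<le> B"
proof -
  have "Bseq (\<lambda>n. padic_abs p (X n))"
    using padic_cauchy_abs[OF assms] Cauchy_convergent_iff Cauchy_Bseq by blast
  thus ?thesis using that by (auto simp: Bseq_def)
qed

lemma padic_cauchy_not_null: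
  assumes "prime p" "padic_cauchy p X" "\<not> padic_null p X"
  obtains b where "b > 0" "eventually (\<lambda>n. padic_abs p (X n) > b) sequentially"
proof -
  obtain L where L: "(\<lambda>n. padic_abs p (X n)) \<longlonglongrightarrow> L"
    using padic_cauchy_abs[OF assms(1,2)] unfolding convergent_def by blast
  have "L \<ge> 0" using L by (rule LIMSEQ_le_const) auto
  moreover have "L \<noteq> 0" using L assms(3) unfolding padic_null_def by auto
  ultimately have "L > 0" by simp
  thus ?thesis using that[of "L / 2"] order_tendstoD(1)[OF L, of "L / 2"] by simp
qed

lemma padic_cauchy_minus: "padic_cauchy p X \<Longrightarrow> padic_cauchy p (\<lambda>n. - X n)"
  unfolding padic_cauchy_def by (simp add: padic_abs_diff_commute)

lemma padic_cauchy_add: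
  assumes p: "prime p" and X: "padic_cauchy p X" and Y: "padic_cauchy p Y"
  shows "padic_cauchy p (\<lambda>n. X n + Y n)"
  unfolding padic_cauchy_def
proof (intro allI impI)
  fix e :: real assume e: "e > 0"
  obtain M where M: "\<forall>m\<ge>M. \<forall>n\<ge>M. padic_abs p (X m - X n) < e"
    using X e unfolding padic_cauchy_def by blast
  obtain N where N: "\<forall>m\<ge>N. \<forall>n\<ge>N. padic_abs p (Y m - Y n) < e"
    using Y e unfolding padic_cauchy_def by blast
  have "padic_abs p (X m + Y m - (X n + Y n)) < e" if "m \<ge> max M N" "n \<ge> max M N" for m n
    using padic_abs_add_le[OF p, of "X m - X n" "Y m - Y n"] M N that
    by (simp add: add_diff_add) (smt (verit))
  thus "\<exists>N. \<forall>m\<ge>N. \<forall>n\<ge>N. padic_abs p (X m + Y m - (X n + Y n)) < e" by blast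
qed

lemma padic_cauchy_mult:
  assumes p: "prime p" and X: "padic_cauchy p X" and Y: "padic_cauchy p Y"
  shows "padic_cauchy p (\<lambda>n. X n * Y n)"
  unfolding padic_cauchy_def
proof (intro allI impI)
  fix e :: real assume e: "e > 0"
  obtain A where A: "A > 0" "\<And>n. padic_abs p (X n) \<le> A"
    by (rule padic_cauchy_bounded[OF p X]) (rule that)
  obtain B where B: "B > 0" "\<And>n. padic_abs p (Y n) \<le> B"
    by (rule padic_cauchy_bounded[OF p Y]) (rule that)
  obtain M where M: "\<forall>m\<ge>M. \<forall>n\<ge>M. padic_abs p (X m - X n) < e / B"
    using X e B(1) unfolding padic_cauchy_def by (meson divide_pos_pos)
  obtain N where N: "\<forall>m\<ge>N. \<forall>n\<ge>N. padic_abs p (Y m - Y n) < e / A"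
    using Y e A(1) unfolding padic_cauchy_def by (meson divide_pos_pos)
  have "padic_abs p (X m * Y m - X n * Y n) < e" if mn: "m \<ge> max M N" "n \<ge> max M N" for m n
  proof -
    have "padic_abs p (X m * (Y m - Y n)) \<le> A * padic_abs p (Y m - Y n)"
      unfolding padic_abs_mult[OF p] using A by (intro mult_right_mono) auto
    also have "\<dots> < A * (e / A)" using A(1) N mn by (intro mult_strict_left_mono) auto
    finally have 1: "padic_abs p (X m * (Y m - Y n)) < e" using A(1) by simp
    have "padic_abs p ((X m - X n) * Y n) \<le> padic_abs p (X m - X n) * B"
      unfolding padic_abs_mult[OF p] using B by (intro mult_left_mono) auto
    also have "\<dots> < e / B * B" using B(1) M mn by (intro mult_strict_right_mono) auto
    finally have 2: "padic_abs p ((X m - X n) * Y n) < e" using B(1) by simp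
    show ?thesis
      using padic_abs_add_le[OF p, of "X m * (Y m - Y n)" "(X m - X n) * Y n"] 1 2
      by (simp add: mult_diff_mult)
  qed
  thus "\<exists>N. \<forall>m\<ge>N. \<forall>n\<ge>N. padic_abs p (X m * Y m - X n * Y n) < e" by blast
qed

lemma padic_null_mult:
  assumes "prime p" "padic_cauchy p X" "padic_null p Y"
  shows "padic_null p (\<lambda>n. X n * Y n)"
proof -
  obtain A where A: "A > 0" "\<And>n. padic_abs p (X n) \<le> A"
    by (rule padic_cauchy_bounded[OF assms(1,2)]) (rule that)
  show ?thesis
    by (rule padic_null_le[OF assms(3), where B = A])
       (auto simp: padic_abs_mult assms intro!: mult_right_mono A always_eventually)
qed

lemma padic_abs_inverse_diff:
  assumes p: "prime p" and b: "b > 0" "padic_abs p x > b" "padic_abs p y > b"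
  shows "padic_abs p (inverse x - inverse y) \<le> inverse b * inverse b * padic_abs p (x - y)"
proof -
  have nz: "x \<noteq> 0" "y \<noteq> 0" using b by auto
  have "padic_abs p (inverse x - inverse y)
      = inverse (padic_abs p x) * padic_abs p (x - y) * inverse (padic_abs p y)"
    by (simp add: inverse_diff_inverse nz padic_abs_mult padic_abs_inverse p)
  also have "\<dots> = inverse (padic_abs p x) * inverse (padic_abs p y) * padic_abs p (x - y)" by simp
  also have "\<dots> \<le> inverse b * inverse b * padic_abs p (x - y)"
    using b by (intro mult_mono) (auto intro!: le_imp_inverse_le)
  finally show ?thesis .
qed

lemma padic_cauchy_inverse:
  assumes p: "prime p" and X: "padic_cauchy p X" "\<not> padic_null p X"
  shows "padic_cauchy p (\<lambda>n. inverse (X n))"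
  unfolding padic_cauchy_def
proof (intro allI impI)
  fix e :: real assume e: "e > 0"
  obtain b where b: "b > 0" "eventually (\<lambda>n. padic_abs p (X n) > b) sequentially"
    by (rule padic_cauchy_not_null[OF p X])
  obtain M where M: "\<forall>n\<ge>M. padic_abs p (X n) > b"
    using b(2) unfolding eventually_sequentially by blast
  obtain N where N: "\<forall>m\<ge>N. \<forall>n\<ge>N. padic_abs p (X m - X n) < e * b * b"
    using X(1) e b(1) unfolding padic_cauchy_def by (metis mult_pos_pos)
  have "padic_abs p (inverse (X m) - inverse (X n)) < e"
    if mn: "m \<ge> max M N" "n \<ge> max M N" for m n
  proof -
    have "padic_abs p (inverse (X m) - inverse (X n))
        \<le> inverse b * inverse b * padic_abs p (X m - X n)"
      using M mn b(1) by (intro padic_abs_inverse_diff[OF p]) auto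
    also have "\<dots> < inverse b * inverse b * (e * b * b)"
      using N mn b(1) by (intro mult_strict_left_mono) auto
    finally show ?thesis using b(1) by (simp add: field_simps)
  qed
  thus "\<exists>N. \<forall>m\<ge>N. \<forall>n\<ge>N. padic_abs p (inverse (X m) - inverse (X n)) < e" by blast
qed

lemma padic_rel_null_cong:
  assumes "prime p" "padic_rel p X Y"
  shows "padic_null p X \<longleftrightarrow> padic_null p Y"
proof
  assume "padic_null p X"
  hence "padic_null p (\<lambda>n. X n + - (X n - Y n))"
    using assms unfolding padic_rel_def by (intro padic_null_add) (auto simp: padic_null_minus simp del: minus_diff_eq)
  thus "padic_null p Y" by simp
next
  assume "padic_null p Y"
  hence "padic_null p (\<lambda>n. Y n + (X n - Y n))"
    using assms unfolding padic_rel_def by (intro padic_null_add) auto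
  thus "padic_null p X" by simp
qed

lemma padic_rel_inverse:
  assumes p: "prime p" and XY: "padic_rel p X Y" and X: "\<not> padic_null p X"
  shows "padic_rel p (\<lambda>n. inverse (X n)) (\<lambda>n. inverse (Y n))"
proof -
  have Y: "\<not> padic_null p Y" using padic_rel_null_cong[OF p XY] X by simp
  have c: "padic_cauchy p X" "padic_cauchy p Y" "padic_null p (\<lambda>n. X n - Y n)"
    using XY unfolding padic_rel_def by auto
  obtain a where a: "a > 0" "eventually (\<lambda>n. padic_abs p (X n) > a) sequentially"
    by (rule padic_cauchy_not_null[OF p c(1) X])
  obtain b where b: "b > 0" "eventually (\<lambda>n. padic_abs p (Y n) > b) sequentially"
    by (rule padic_cauchy_not_null[OF p c(2) Y])
  let ?c = "min a b"
  have "padic_null p (\<lambda>n. inverse (X n) - inverse (Y n))"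
  proof (rule padic_null_le[OF c(3)])
    show "\<forall>\<^sub>F n in sequentially. padic_abs p (inverse (X n) - inverse (Y n))
        \<le> inverse ?c * inverse ?c * padic_abs p (X n - Y n)"
      using a(2) b(2)
      by eventually_elim (rule padic_abs_inverse_diff[OF p], use a b in auto)
  qed
  thus ?thesis unfolding padic_rel_def
    using padic_cauchy_inverse[OF p] c X Y by auto
qed

lemma part_equivp_padic_rel:
  assumes "prime p" shows "part_equivp (padic_rel p)"
proof (rule part_equivpI)
  show "\<exists>x. padic_rel p x x" by (intro exI[of _ "\<lambda>n. 0"]) (simp add: padic_rel_def)
  show "symp (padic_rel p)"
    by (auto simp: symp_def padic_rel_def padic_null_def padic_abs_diff_commute)
  show "transp (padic_rel p)"
  proof (rule transpI)
    fix X Y Z assume "padic_rel p X Y" "padic_rel p Y Z"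
    thus "padic_rel p X Z" unfolding padic_rel_def
      using padic_null_add[OF assms, of "\<lambda>n. X n - Y n" "\<lambda>n. Y n - Z n"] by auto
  qed
qed

section \<open>The field of \<open>p\<close>-adic numbers\<close>

text \<open>
  The completion of the rationals with respect to \<^const>\<open>padic_abs\<close>. The prime \<open>p\<close> is given by
  the cardinality of the type parameter.
\<close>

typedef (overloaded) 'p padic =
    "{{Y. padic_rel CARD('p::prime_card) X Y} | X. padic_cauchy CARD('p) X}"
  by (auto intro!: exI[of _ "\<lambda>n. 0"])

definition padic_of_seq :: "(nat \<Rightarrow> rat) \<Rightarrow> 'p::prime_card padic" where
  "padic_of_seq X = Abs_padic {Y. padic_rel CARD('p) X Y}"

definition seq_of_padic :: "'p::prime_card padic \<Rightarrow> (nat \<Rightarrow> rat)" where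
  "seq_of_padic x = (SOME X. X \<in> Rep_padic x)"

definition cr_padic :: "(nat \<Rightarrow> rat) \<Rightarrow> 'p::prime_card padic \<Rightarrow> bool" where
  "cr_padic X x \<longleftrightarrow> padic_cauchy CARD('p) X \<and> padic_of_seq X = x"

lemma Quotient_padic:
  "Quotient (padic_rel CARD('p)) padic_of_seq seq_of_padic
     (cr_padic :: _ \<Rightarrow> 'p::prime_card padic \<Rightarrow> bool)"
proof -
  let ?R = "padic_rel CARD('p)"
  have refl: "?R X X \<longleftrightarrow> padic_cauchy CARD('p) X" for X by (simp add: padic_rel_def)
  have sym: "?R X Y \<Longrightarrow> ?R Y X" for X Y
    using part_equivp_symp[OF part_equivp_padic_rel[OF prime_card]] .
  have trans: "?R X Y \<Longrightarrow> ?R Y Z \<Longrightarrow> ?R X Z" for X Y Z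
    using part_equivp_transp[OF part_equivp_padic_rel[OF prime_card]] .
  have Rep_of_seq: "Rep_padic (padic_of_seq X :: 'p padic) = {Y. ?R X Y}"
    if "padic_cauchy CARD('p) X" for X
    unfolding padic_of_seq_def using that by (subst Abs_padic_inverse) auto
  have rep: "padic_cauchy CARD('p) (seq_of_padic x)" "padic_of_seq (seq_of_padic x) = x"
    for x :: "'p padic"
  proof -
    obtain X where X: "padic_cauchy CARD('p) X" "Rep_padic x = {Y. ?R X Y}"
      using Rep_padic[of x] by auto
    hence "X \<in> Rep_padic x" by (simp add: refl)
    hence "seq_of_padic x \<in> Rep_padic x" unfolding seq_of_padic_def by (rule someI[of "\<lambda>X. X \<in> Rep_padic x"])
    hence XS: "?R X (seq_of_padic x)" using X by simp
    thus S: "padic_cauchy CARD('p) (seq_of_padic x)" by (simp add: padic_rel_def)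
    have "{Y. ?R X Y} = {Y. ?R (seq_of_padic x) Y}" using XS sym trans by blast
    thus "padic_of_seq (seq_of_padic x) = x"
      using Rep_of_seq[OF S] X(2) by (simp flip: Rep_padic_inject)
  qed
  have eq: "padic_of_seq X = (padic_of_seq Y :: 'p padic) \<longleftrightarrow> ?R X Y"
    if "padic_cauchy CARD('p) X" "padic_cauchy CARD('p) Y" for X Y
    unfolding Rep_padic_inject[symmetric] Rep_of_seq[OF that(1)] Rep_of_seq[OF that(2)]
    using that sym trans refl by blast
  show ?thesis unfolding Quotient_def
    using rep eq by (auto simp: refl fun_eq_iff cr_padic_def) (auto simp: padic_rel_def)
qed

setup_lifting Quotient_padic

lemma padic_abs_card_eq_0_iff [simp]:
  "padic_abs CARD('p::prime_card) x = 0 \<longleftrightarrow> x = 0"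
  by (rule padic_abs_eq_0_iff[OF prime_card])

lemma padic_domainp [transfer_domain_rule]:
  "Domainp (pcr_padic :: _ \<Rightarrow> 'p::prime_card padic \<Rightarrow> bool) = padic_cauchy CARD('p)"
  by (simp add: padic.domain_eq padic_rel_def)

instantiation padic :: (prime_card) field
begin

lift_definition zero_padic :: "'a padic" is "\<lambda>n. 0"
  by (simp add: padic_rel_def)

lift_definition one_padic :: "'a padic" is "\<lambda>n. 1"
  by (simp add: padic_rel_def)

lift_definition plus_padic :: "'a padic \<Rightarrow> 'a padic \<Rightarrow> 'a padic" is "\<lambda>X Y n. X n + Y n"
  unfolding padic_rel_def add_diff_add
  by (auto intro: padic_cauchy_add padic_null_add prime_card)

lift_definition uminus_padic :: "'a padic \<Rightarrow> 'a padic" is "\<lambda>X n. - X n"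
  unfolding padic_rel_def minus_diff_minus
  by (auto intro: padic_cauchy_minus simp: padic_null_minus simp del: minus_diff_eq)

lift_definition times_padic :: "'a padic \<Rightarrow> 'a padic \<Rightarrow> 'a padic" is "\<lambda>X Y n. X n * Y n"
proof -
  fix X X' Y Y' :: "nat \<Rightarrow> rat"
  let ?p = "CARD('a)"
  assume "padic_rel ?p X X'" "padic_rel ?p Y Y'"
  hence c: "padic_cauchy ?p X" "padic_cauchy ?p X'" "padic_cauchy ?p Y" "padic_cauchy ?p Y'"
    and n: "padic_null ?p (\<lambda>n. X n - X' n)" "padic_null ?p (\<lambda>n. Y n - Y' n)"
    by (auto simp: padic_rel_def)
  have "padic_null ?p (\<lambda>n. X n * (Y n - Y' n) + Y' n * (X n - X' n))"
    by (intro padic_null_add padic_null_mult prime_card c n)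
  thus "padic_rel ?p (\<lambda>n. X n * Y n) (\<lambda>n. X' n * Y' n)"
    unfolding padic_rel_def using c by (auto intro: padic_cauchy_mult prime_card simp: algebra_simps)
qed

lift_definition inverse_padic :: "'a padic \<Rightarrow> 'a padic"
  is "\<lambda>X. if padic_null CARD('a) X then (\<lambda>n. 0) else (\<lambda>n. inverse (X n))"
proof -
  fix X Y assume "padic_rel CARD('a) X Y"
  thus "padic_rel CARD('a)
      (if padic_null CARD('a) X then (\<lambda>n. 0) else (\<lambda>n. inverse (X n)))
      (if padic_null CARD('a) Y then (\<lambda>n. 0) else (\<lambda>n. inverse (Y n)))"
    using padic_rel_null_cong[OF prime_card, of X Y] padic_rel_inverse[OF prime_card, of X Y]
    by (auto simp: padic_rel_def)
qed

definition minus_padic :: "'a padic \<Rightarrow> 'a padic \<Rightarrow> 'a padic" where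
  "minus_padic x y = x + - y"

definition divide_padic :: "'a padic \<Rightarrow> 'a padic \<Rightarrow> 'a padic" where
  "divide_padic x y = x * inverse y"

instance
proof
  note cauchy = padic_cauchy_add padic_cauchy_mult padic_cauchy_minus prime_card
  fix a b c :: "'a padic"
  show "a + b = b + a"
    by transfer (simp add: ac_simps padic_rel_def cauchy)
  show "(a + b) + c = a + (b + c)"
    by transfer (simp add: ac_simps padic_rel_def cauchy)
  show "0 + a = a"
    by transfer (simp add: padic_rel_def)
  show "- a + a = 0"
    by transfer (simp add: padic_rel_def)
  show "a - b = a + - b"
    by (rule minus_padic_def)
  show "(a * b) * c = a * (b * c)"
    by transfer (simp add: ac_simps padic_rel_def cauchy)
  show "a * b = b * a"
    by transfer (simp add: ac_simps padic_rel_def cauchy)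
  show "1 * a = a"
    by transfer (simp add: padic_rel_def)
  show "(a + b) * c = a * c + b * c"
    by transfer (simp add: distrib_right padic_rel_def cauchy)
  show "(0 :: 'a padic) \<noteq> 1"
    by transfer (simp add: padic_rel_def padic_null_def LIMSEQ_const_iff)
  show "a div b = a * inverse b"
    by (rule divide_padic_def)
  show "inverse (0 :: 'a padic) = 0"
    by transfer (simp add: padic_rel_def)
  show "a \<noteq> 0 \<Longrightarrow> inverse a * a = 1"
  proof transfer
    fix X assume X: "padic_cauchy CARD('a) X" and nz: "\<not> padic_rel CARD('a) X (\<lambda>n. 0)"
    hence nn: "\<not> padic_null CARD('a) X" by (simp add: padic_rel_def)
    obtain b where b: "b > 0" "eventually (\<lambda>n. padic_abs CARD('a) (X n) > b) sequentially"
      by (rule padic_cauchy_not_null[OF prime_card X nn])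
    have 1: "inverse x * x = 1" if "padic_abs CARD('a) x > b" for x
      using b(1) that by (cases "x = 0") auto
    from b(2) have "eventually (\<lambda>n. padic_abs CARD('a) (inverse (X n) * X n - 1)
        \<le> 0 * padic_abs CARD('a) 0) sequentially"
      by eventually_elim (simp add: 1)
    hence "padic_null CARD('a) (\<lambda>n. inverse (X n) * X n - 1)"
      by (rule padic_null_le[rotated]) simp
    thus "padic_rel CARD('a) (\<lambda>n. (if padic_null CARD('a) X then \<lambda>n. 0
        else (\<lambda>n. inverse (X n))) n * X n) (\<lambda>n. 1)"
      using X nn by (auto simp: padic_rel_def intro!: padic_cauchy_mult padic_cauchy_inverse prime_card)
  qed
qed

end

lift_definition padic_norm :: "'a::prime_card padic \<Rightarrow> real" is "\<lambda>X. lim (\<lambda>n. padic_abs CARD('a) (X n))"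
proof -
  fix X Y :: "nat \<Rightarrow> rat"
  let ?v = "padic_abs CARD('a)"
  assume XY: "padic_rel CARD('a) X Y"
  obtain L where L: "(\<lambda>n. ?v (Y n)) \<longlonglongrightarrow> L"
    using padic_cauchy_abs[OF prime_card, of Y] XY unfolding padic_rel_def convergent_def by blast
  have "(\<lambda>n. ?v (X n) - ?v (Y n)) \<longlonglongrightarrow> 0"
  proof (rule tendsto_0_le)
    show "eventually (\<lambda>n. norm (?v (X n) - ?v (Y n)) \<le> norm (?v (X n - Y n)) * 1) sequentially"
      by (auto simp: padic_abs_triangle_diff[OF prime_card] intro!: always_eventually)
    show "(\<lambda>n. ?v (X n - Y n)) \<longlonglongrightarrow> 0" using XY by (simp add: padic_rel_def padic_null_def)
  qed
  from tendsto_add[OF this L] L show "lim (\<lambda>n. ?v (X n)) = lim (\<lambda>n. ?v (Y n))"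
    by (simp add: limI)
qed

lemma padic_abs_tendsto:
  assumes "padic_cauchy CARD('p::prime_card) X"
  shows "(\<lambda>n. padic_abs CARD('p) (X n)) \<longlonglongrightarrow> lim (\<lambda>n. padic_abs CARD('p) (X n))"
  using padic_cauchy_abs[OF prime_card assms] by (simp add: convergent_LIMSEQ_iff)

lemma padic_norm_nonneg [simp]: "padic_norm (x :: 'p::prime_card padic) \<ge> 0"
  by transfer (rule LIMSEQ_le_const[OF padic_abs_tendsto], auto)

lemma padic_norm_eq_0_iff [simp]: "padic_norm x = 0 \<longleftrightarrow> x = (0 :: 'p::prime_card padic)"
proof transfer
  fix X assume X: "padic_cauchy CARD('p) X"
  show "lim (\<lambda>n. padic_abs CARD('p) (X n)) = 0 \<longleftrightarrow> padic_rel CARD('p) X (\<lambda>n. 0)"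
    using padic_abs_tendsto[OF X] X
    by (simp add: padic_rel_def padic_null_def) (metis limI)
qed

lemma padic_norm_mult: "padic_norm (x * y) = padic_norm x * padic_norm (y :: 'p::prime_card padic)"
  by transfer (auto simp: padic_abs_mult[OF prime_card] intro!: limI tendsto_mult padic_abs_tendsto)

lemma padic_norm_minus [simp]: "padic_norm (- x) = padic_norm (x :: 'p::prime_card padic)"
  by transfer simp

lemma padic_norm_add_le: "padic_norm (x + y) \<le> max (padic_norm x) (padic_norm (y :: 'p::prime_card padic))"
  by transfer (rule LIMSEQ_le[OF padic_abs_tendsto tendsto_max[OF padic_abs_tendsto padic_abs_tendsto]],
      auto intro!: padic_cauchy_add padic_abs_add_le prime_card)

lemma pcr_padic_of_nat: "pcr_padic (\<lambda>_. of_nat k) (of_nat k :: 'p::prime_card padic)"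
proof (induction k)
  case 0
  show ?case using zero_padic.transfer by simp
next
  case (Suc k)
  show ?case
    using plus_padic.transfer[THEN rel_funD, OF one_padic.transfer, THEN rel_funD, OF Suc.IH] by simp
qed

lemma padic_norm_of_nat_diff:
  "padic_norm (of_nat k - of_nat l :: 'p::prime_card padic) = padic_abs CARD('p) (of_nat k - of_nat l)"
proof -
  have "pcr_padic (\<lambda>_. of_nat k + - of_nat l) (of_nat k + - of_nat l :: 'p padic)"
    by (rule plus_padic.transfer[THEN rel_funD, OF pcr_padic_of_nat, THEN rel_funD,
          OF uminus_padic.transfer[THEN rel_funD, OF pcr_padic_of_nat]])
  from padic_norm.transfer[THEN rel_funD, OF this] show ?thesis by simp
qed

instance padic :: (prime_card) field_char_0
proof
  have *: "padic_norm (of_nat k - of_nat l :: 'a padic) = padic_abs CARD('a) (of_nat k - of_nat l)"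
    for k l by (simp add: padic_norm_of_nat_diff)
  show "inj (of_nat :: nat \<Rightarrow> 'a padic)"
  proof (rule injI)
    fix k l :: nat
    assume "(of_nat k :: 'a padic) = of_nat l"
    hence "padic_abs CARD('a) (of_nat k - of_nat l) = 0" unfolding *[symmetric] by (simp add: padic_norm_eq_0_iff[THEN iffD2])
    thus "k = l" by simp
  qed
qed

lemma padic_norm_of_int: "padic_norm (of_int k :: 'p::prime_card padic) = padic_abs CARD('p) (of_int k)"
proof -
  have *: "padic_norm (of_nat n :: 'p padic) = padic_abs CARD('p) (of_nat n)" for n
    using padic_norm_of_nat_diff[of n 0] by simp
  show ?thesis by (cases k rule: int_cases2) (simp_all add: *)
qed

lemma padic_norm_of_rat: "padic_norm (of_rat q :: 'p::prime_card padic) = padic_abs CARD('p) q"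
proof -
  obtain a b where ab: "quotient_of q = (a, b)" by (cases "quotient_of q")
  have b: "b > 0" using quotient_of_denom_pos[OF ab] .
  have q: "q = of_int a / of_int b" using quotient_of_div[OF ab] .
  have "padic_norm (of_rat q * of_rat (of_int b) :: 'p padic) = padic_abs CARD('p) (q * of_int b)"
    using b unfolding of_rat_mult[symmetric] by (simp add: q padic_norm_of_int)
  thus ?thesis using b by (simp add: padic_norm_mult padic_norm_of_int padic_abs_mult[OF prime_card])
qed

definition padic_sphere :: "real \<Rightarrow> 'p::prime_card padic set" where
  "padic_sphere r = {x. padic_norm x = r}"

text \<open>
  The sphere is empty unless \<open>r\<close> is \<open>0\<close> or an integral power of \<open>p\<close>; an empty sphere is
  vacuously invariant under any map.
\<close>

section \<open>Invariant sets of partial maps\<close>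

text \<open>
  An iterate is undefined at \<open>x\<close> as soon as the orbit of \<open>x\<close> leaves the domain of \<open>f\<close>.
\<close>

primrec partial_iterate :: "('a \<rightharpoonup> 'a) \<Rightarrow> nat \<Rightarrow> ('a \<rightharpoonup> 'a)" where
  "partial_iterate f 0 = Some"
| "partial_iterate f (Suc n) = f \<circ>\<^sub>m partial_iterate f n"

definition invariant_for :: "('a \<rightharpoonup> 'a) \<Rightarrow> 'a set \<Rightarrow> bool" where
  "invariant_for f S \<longleftrightarrow> (\<forall>x\<in>S. \<forall>n\<ge>1. \<exists>y\<in>S. partial_iterate f n x = Some y)"

section \<open>The rational map and the set of radii\<close>

definition rational_map :: "'a::field \<Rightarrow> 'a \<Rightarrow> 'a \<Rightarrow> 'a \<Rightarrow> ('a \<rightharpoonup> 'a)" where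
  "rational_map a b x1 x2 x =
     (if x \<noteq> x1 \<and> x \<noteq> x2 then Some ((a * x^2 + b * x) / (x^2 + a * x + b)) else None)"

text \<open>
  When \<open>\<delta>\<close>, \<open>\<alpha>\<close>, \<open>\<beta>\<close> are the norms of \<open>a\<close> and of the two zeros, exactly one of the first two
  cases applies, so the value in the third case is irrelevant.
\<close>

definition invariant_radii :: "real \<Rightarrow> real \<Rightarrow> real \<Rightarrow> real set" where
  "invariant_radii \<delta> \<alpha> \<beta> =
     (if \<delta> \<le> \<alpha> \<and> \<alpha> = \<beta> then {r. 0 \<le> r \<and> r < \<alpha>}
      else if \<alpha> < \<beta> \<and> \<beta> = \<delta> then {0..<\<beta>} - {\<alpha>}
      else {})"

end

(* With x1 + x2 = -a and x1 * x2 = b, the map is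
     f(x) = x * (x2 * (x1 - x) - x1 * x) / ((x - x1) * (x - x2)).
   For |x| = r < |x2| and r \<noteq> |x1| the strong triangle inequality gives
   |x - x1| = max r |x1|, |x - x2| = |x2| and |x2 * (x1 - x)| > |x1 * x|, so all factors other
   than x cancel and |f(x)| = r.  If r is |x1| or |x2|, the sphere contains a pole; if r > |x2|,
   then |f(x)| \<le> |x2| < r.  Finally, both cases of the set of radii amount to
   r < |x2| and r \<noteq> |x1|. *)
theory Submission
  imports Defs
begin

lemma padic_norm_0 [simp]: "padic_norm (0 :: 'p::prime_card padic) = 0"
  by (simp only: padic_norm_eq_0_iff)

text \<open>Multiplicativity applied to \<open>(x / y) * y = x\<close>. For \<open>y = 0\<close>
  both quotients are 0 by the convention on division.\<close>

lemma padic_norm_divide: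
  "padic_norm (x / y) = padic_norm x / padic_norm (y :: 'p::prime_card padic)"
proof (cases "y = 0")
  case False
  then have "padic_norm (x / y) * padic_norm y = padic_norm x"
    by (simp flip: padic_norm_mult)
  with False show ?thesis by (simp add: eq_divide_eq)
qed simp

lemma padic_norm_minus_commute:
  "padic_norm (x - y) = padic_norm (y - x :: 'p::prime_card padic)"
  using padic_norm_minus[of "x - y"] by simp

lemma padic_norm_diff_le:
  "padic_norm (x - y) \<le> max (padic_norm x) (padic_norm (y :: 'p::prime_card padic))"
  using padic_norm_add_le[of x "- y"] by simp

text \<open>Isosceles principle: in \<open>x = (x - y) + y\<close> the maximum of the two norms
  cannot come from \<open>y\<close>, whose norm is too small.\<close>

lemma padic_norm_diff_eq_left:
  assumes "padic_norm y < padic_norm (x :: 'p::prime_card padic)"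
  shows "padic_norm (x - y) = padic_norm x"
proof (rule antisym)
  show "padic_norm (x - y) \<le> padic_norm x"
    using padic_norm_diff_le[of x y] assms by linarith
  have "padic_norm x \<le> max (padic_norm (x - y)) (padic_norm y)"
    using padic_norm_add_le[of "x - y" y] by (simp only: diff_add_cancel)
  then show "padic_norm x \<le> padic_norm (x - y)"
    using assms by linarith
qed

lemma padic_norm_diff_eq_max:
  assumes "padic_norm x \<noteq> padic_norm (y :: 'p::prime_card padic)"
  shows "padic_norm (x - y) = max (padic_norm x) (padic_norm y)"
proof (cases "padic_norm y < padic_norm x")
  case True
  then show ?thesis using padic_norm_diff_eq_left[OF True] by linarith
next
  case False
  with assms have less: "padic_norm x < padic_norm y" by linarith
  then show ?thesis
    using padic_norm_diff_eq_left[OF less] padic_norm_minus_commute[of x y] by linarith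
qed

text \<open>Once a single step stays in \<open>S\<close>, induction keeps the whole orbit defined
  and in \<open>S\<close>; the iterate 0, which is \<open>x\<close> itself, serves as base
  case.\<close>

lemma invariant_for_iff: "invariant_for f S \<longleftrightarrow> (\<forall>x\<in>S. \<exists>y\<in>S. f x = Some y)"
proof
  assume "invariant_for f S"
  then have "\<forall>x\<in>S. \<exists>y\<in>S. partial_iterate f 1 x = Some y"
    unfolding invariant_for_def by blast
  then show "\<forall>x\<in>S. \<exists>y\<in>S. f x = Some y" by simp
next
  assume step: "\<forall>x\<in>S. \<exists>y\<in>S. f x = Some y"
  have "\<exists>y\<in>S. partial_iterate f n x = Some y" if "x \<in> S" for x n
  proof (induction n)
    case 0
    show ?case using that by simp
  next
    case (Suc n)
    then obtain y where "y \<in> S" "partial_iterate f n x = Some y" by blast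
    with step show ?case by simp
  qed
  then show "invariant_for f S" unfolding invariant_for_def by blast
qed

text \<open>Vieta's formulas. The set equation leaves open which root carries the plus sign, so both
  labellings are treated.\<close>

lemma quadratic_roots_sum_prod:
  fixes a b x1 x2 :: "'a::field_char_0"
  assumes "s\<^sup>2 = a\<^sup>2 - 4 * b" "{x1, x2} = {(- a + s) / 2, (- a - s) / 2}"
  shows "a = - (x1 + x2)" and "b = x1 * x2"
proof -
  have roots: "x1 = (- a + s) / 2 \<and> x2 = (- a - s) / 2 \<or> x1 = (- a - s) / 2 \<and> x2 = (- a + s) / 2"
    using assms(2) by (auto simp: doubleton_eq_iff)
  then have "x1 + x2 = - a"
    by (elim disjE conjE) (simp_all only: add_divide_distrib[symmetric], simp_all)
  then show "a = - (x1 + x2)" by simp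
  \<comment> \<open>Doubling both roots clears the denominators; the right side is
    \<open>a\<^sup>2 - s\<^sup>2\<close>.\<close>
  have "(2 * x1) * (2 * x2) = (- a + s) * (- a - s)"
    using roots by (elim disjE conjE) (simp_all only: nonzero_mult_div_cancel_left mult.commute
        times_divide_eq_right zero_neq_numeral[symmetric] not_False_eq_True simp_thms)
  also have "\<dots> = 4 * b"
    using assms(1) by (simp add: algebra_simps power2_eq_square)
  finally show "b = x1 * x2" by simp
qed

text \<open>Uses \<open>a * x + b = x2 * (x1 - x) - x1 * x\<close>, a splitting whose two terms can
  be compared in norm. At a pole both sides are 0.\<close>

lemma padic_norm_rational_map:
  fixes x x1 x2 :: "'p::prime_card padic"
  assumes "a = - (x1 + x2)" "b = x1 * x2"
  shows "padic_norm ((a * x\<^sup>2 + b * x) / (x\<^sup>2 + a * x + b))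
    = padic_norm x * padic_norm (x2 * (x1 - x) - x1 * x)
      / (padic_norm (x - x1) * padic_norm (x - x2))"
proof -
  have "(a * x\<^sup>2 + b * x) / (x\<^sup>2 + a * x + b)
      = x * (x2 * (x1 - x) - x1 * x) / ((x - x1) * (x - x2))"
    unfolding assms by (simp add: algebra_simps power2_eq_square)
  then show ?thesis by (simp add: padic_norm_divide padic_norm_mult)
qed

lemma padic_norm_rational_map_inside:
  fixes x x1 x2 :: "'p::prime_card padic"
  assumes ab: "a = - (x1 + x2)" "b = x1 * x2"
    and le: "padic_norm x1 \<le> padic_norm x2"
    and x: "padic_norm x < padic_norm x2" "padic_norm x \<noteq> padic_norm x1"
  shows "padic_norm ((a * x\<^sup>2 + b * x) / (x\<^sup>2 + a * x + b)) = padic_norm x"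
proof -
  define m where "m = max (padic_norm x) (padic_norm x1)"
  \<comment> \<open>Positivity holds because \<open>m\<close> is the larger of two distinct
    nonnegative numbers.\<close>
  have m: "m > 0" "padic_norm x \<le> m" "padic_norm x1 \<le> m"
    using x(2) padic_norm_nonneg[of x] padic_norm_nonneg[of x1] unfolding m_def by linarith+
  have b0: "padic_norm x2 > 0"
    using x(1) padic_norm_nonneg[of x] by linarith
  have 1: "padic_norm (x - x1) = m"
    unfolding m_def using x(2) by (rule padic_norm_diff_eq_max)
  have 2: "padic_norm (x - x2) = padic_norm x2"
    using padic_norm_diff_eq_left[OF x(1)] by (simp add: padic_norm_minus_commute)
  have 3: "padic_norm (x2 * (x1 - x)) = padic_norm x2 * m"
    by (simp only: padic_norm_mult padic_norm_minus_commute[of x1 x] 1)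
  \<comment> \<open>This chain shows that \<open>x2 * (x1 - x)\<close> dominates, so the second
    factor of the numerator has norm |x2| m, exactly that of the denominator.\<close>
  have "padic_norm x1 * padic_norm x \<le> m * padic_norm x"
    using m by (intro mult_right_mono) auto
  also have "\<dots> < m * padic_norm x2"
    using m x(1) by (intro mult_strict_left_mono) auto
  finally have "padic_norm (x1 * x) < padic_norm (x2 * (x1 - x))"
    unfolding 3 by (simp only: padic_norm_mult mult.commute)
  from padic_norm_diff_eq_left[OF this] show ?thesis
    unfolding padic_norm_rational_map[OF ab] 1 2 3 using m(1) b0 by auto
qed

lemma padic_norm_rational_map_outside:
  fixes x x1 x2 :: "'p::prime_card padic"
  assumes ab: "a = - (x1 + x2)" "b = x1 * x2"
    and le: "padic_norm x1 \<le> padic_norm x2"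
    and x: "padic_norm x2 < padic_norm x"
  shows "padic_norm ((a * x\<^sup>2 + b * x) / (x\<^sup>2 + a * x + b)) \<le> padic_norm x2"
proof -
  have x0: "padic_norm x > 0" using x padic_norm_nonneg[of x2] by linarith
  have 1: "padic_norm (x - x1) = padic_norm x"
    using le x by (intro padic_norm_diff_eq_left) simp
  have 2: "padic_norm (x - x2) = padic_norm x"
    using x by (rule padic_norm_diff_eq_left)
  \<comment> \<open>Only an upper bound is available: the two terms may have equal norm and
    cancel.\<close>
  have "padic_norm (x2 * (x1 - x) - x1 * x)
      \<le> max (padic_norm x2 * padic_norm x) (padic_norm x1 * padic_norm x)"
    using padic_norm_diff_le[of "x2 * (x1 - x)" "x1 * x"]
    unfolding padic_norm_mult padic_norm_minus_commute[of x1 x] 1 .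
  also have "\<dots> = padic_norm x2 * padic_norm x"
    using le by (simp add: max_absorb1 mult_right_mono)
  finally show ?thesis
    unfolding padic_norm_rational_map[OF ab] 1 2 using x0 by (simp add: field_simps)
qed

lemma mem_invariant_radii_iff:
  fixes x1 x2 :: "'p::prime_card padic"
  assumes a: "a = - (x1 + x2)"
    and le: "padic_norm x1 \<le> padic_norm x2" and "r \<ge> 0"
  shows "r \<in> invariant_radii (padic_norm a) (padic_norm x1) (padic_norm x2)
    \<longleftrightarrow> r < padic_norm x2 \<and> r \<noteq> padic_norm x1"
proof -
  \<comment> \<open>Writing the sum of the roots as a difference makes the isosceles principle
    applicable: |a| = |x2| whenever |x1| < |x2|. Hence the default case of
    \<open>invariant_radii\<close> never occurs.\<close>
  have "padic_norm a = padic_norm (x2 - - x1)"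
    using padic_norm_minus[of "x1 + x2"] unfolding a by (simp add: add.commute)
  then have "padic_norm a \<le> padic_norm x2"
    and "padic_norm x1 = padic_norm x2 \<or> padic_norm a = padic_norm x2"
    using padic_norm_diff_le[of x2 "- x1"] padic_norm_diff_eq_left[of "- x1" x2] le
    by (auto simp: le_less)
  then show ?thesis
    using le \<open>r \<ge> 0\<close> unfolding invariant_radii_def
    by (cases "padic_norm x1 = padic_norm x2") (simp_all add: less_le)
qed

theorem corollary1:
  fixes a b x1 x2 :: "'p::prime_card padic" and r :: real
  assumes "a \<noteq> 0"
    and "\<exists>s. s^2 = a^2 - 4 * b \<and> {x1, x2} = {(- a + s) / 2, (- a - s) / 2}"
    and "padic_norm x1 \<le> padic_norm x2"
    and "r \<ge> 0"
    and "padic_sphere r \<noteq> ({} :: 'p padic set)"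
  shows "invariant_for (rational_map a b x1 x2) (padic_sphere r)
     \<longleftrightarrow> r \<in> invariant_radii (padic_norm a) (padic_norm x1) (padic_norm x2)"
proof -
  obtain s where "s\<^sup>2 = a\<^sup>2 - 4 * b" "{x1, x2} = {(- a + s) / 2, (- a - s) / 2}"
    using assms(2) by blast
  then have ab: "a = - (x1 + x2)" "b = x1 * x2"
    by (rule quadratic_roots_sum_prod)+
  have "invariant_for (rational_map a b x1 x2) (padic_sphere r)
    \<longleftrightarrow> r < padic_norm x2 \<and> r \<noteq> padic_norm x1"
  proof
    assume r: "r < padic_norm x2 \<and> r \<noteq> padic_norm x1"
    show "invariant_for (rational_map a b x1 x2) (padic_sphere r)"
      unfolding invariant_for_iff
    proof
      fix x :: "'p padic"
      assume "x \<in> padic_sphere r"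
      then have x: "padic_norm x = r" by (simp add: padic_sphere_def)
      with r have "x \<noteq> x1" "x \<noteq> x2" by auto
      with r x show "\<exists>y\<in>padic_sphere r. rational_map a b x1 x2 x = Some y"
        using padic_norm_rational_map_inside[OF ab assms(3), of x]
        by (simp add: rational_map_def padic_sphere_def)
    qed
  next
    assume "invariant_for (rational_map a b x1 x2) (padic_sphere r)"
    then have inv: "x \<noteq> x1 \<and> x \<noteq> x2 \<and> padic_norm ((a * x\<^sup>2 + b * x) / (x\<^sup>2 + a * x + b)) = r"
      if "padic_norm x = r" for x
      using that unfolding invariant_for_iff
      by (auto simp: rational_map_def padic_sphere_def split: if_splits)
    \<comment> \<open>Otherwise \<open>x1\<close> or \<open>x2\<close> itself would be a point of
      the sphere at which the map is undefined.\<close>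
    have "r \<noteq> padic_norm x1" "r \<noteq> padic_norm x2"
      using inv by blast+
    moreover have "\<not> padic_norm x2 < r"
    proof
      assume less: "padic_norm x2 < r"
      \<comment> \<open>A point is needed to contradict invariance, since an empty sphere is
        vacuously invariant.\<close>
      obtain x :: "'p padic" where x: "padic_norm x = r"
        using assms(5) by (auto simp: padic_sphere_def)
      with less have "padic_norm ((a * x\<^sup>2 + b * x) / (x\<^sup>2 + a * x + b)) \<le> padic_norm x2"
        by (intro padic_norm_rational_map_outside[OF ab assms(3)]) simp
      with inv[OF x] less show False by linarith
    qed
    ultimately show "r < padic_norm x2 \<and> r \<noteq> padic_norm x1" by simp
  qed
  then show ?thesis
    using mem_invariant_radii_iff[OF ab(1) assms(3,4)] by simp
qed

end
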